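(* For every integer $n\ge 1$, the Cayley element $C_{\mathcal U}(x_0,x_1,\ldots,x_n):=x_0^{n-1}\sigma(x_n)$ of the Chebyshev second kind derivation $D_{\mathcal U}$ belongs to $\ker D_{\mathcal U}$ and is given by $$C_{\mathcal U}(x_0,\ldots,x_n)=x_nx_0^{n-1}+\sum_{k=1}^{n}\frac{(-1)^k}{k!}\sum_{i=0}^{\left[\frac{n-k}{2}\right]}(n-i)^{\underline{k-1}}\binom{k+i-1}{k-1}(n-k-2i+1)\,x_{n-k-2i}\,x_1^k\,x_0^{n-1-k}.$$
   Context: A derivation $D$ of $\mathbb{C}[x_0,\ldots,x_n]$ is a $\mathbb{C}$-linear map with $D(fg)=D(f)g+fD(g)$; it extends to the field of fractions by the quotient rule, and $\ker D=\{f\in\mathbb{C}[x_0,\ldots,x_n]: D(f)=0\}$. The Chebyshev second kind derivation $D_{\mathcal U}$ of $\mathbb{C}[x_0,\ldots,x_n]$ is given by $D_{\mathcal U}(x_0)=0$ and, for $1\le m\le n$, $$D_{\mathcal U}(x_m)=\sum_{k=0}^{m-1}\left(1+(-1)^{m-k+1}\right)(k+1)x_k.$$ It is locally nilpotent, with $D_{\mathcal U}(x_1)=2x_0$. Put $\lambda=-\frac{x_1}{2x_0}$ (so $D_{\mathcal U}(\lambda)=-1$) and $\sigma(x_n)=\sum_{k=0}^{\infty}D_{\mathcal U}^k(x_n)\frac{\lambda^k}{k!}$ (a finite sum, an element of $\mathbb{C}[x_0,\ldots,x_n][x_0^{-1}]$). The elements $x_0^{n-1}\sigma(x_n)$ are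 called the Cayley elements of the Chebyshev second kind derivation. Notation: $[a]$ in summation limits is the integer part; $a^{\underline m}=a(a-1)\cdots(a-m+1)$ is the falling factorial ($a^{\underline 0}=1$). *)

theory Defs
  imports
    Complex_Main
    "HOL-Library.Poly_Mapping"
    "HOL-Computational_Algebra.Polynomial_Factorial"
begin

text \<open>
  Polynomials in the variables \<open>x\<^sub>0, x\<^sub>1, \<dots>\<close> over the complex numbers: a monomial is a finitely
  supported exponent function, a polynomial a finitely supported coefficient function.  This type is
  an integral domain; \<open>\<complex>[x\<^sub>0, \<dots>, x\<^sub>n]\<close> is the subring \<open>poly_ring n\<close> of it.
\<close>

type_synonym cpoly = "(nat \<Rightarrow>\<^sub>0 nat) \<Rightarrow>\<^sub>0 complex"

definition const :: "complex \<Rightarrow> cpoly" where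
  "const c = Poly_Mapping.single 0 c"

definition var :: "nat \<Rightarrow> cpoly" where
  "var i = Poly_Mapping.single (Poly_Mapping.single i 1) 1"

definition poly_ring :: "nat \<Rightarrow> cpoly set" where
  "poly_ring n = {p. \<forall>t \<in> Poly_Mapping.keys p. Poly_Mapping.keys t \<subseteq> {..n}}"

text \<open>Derivations of \<open>\<complex>[x\<^sub>0, \<dots>, x\<^sub>n]\<close>; nothing is said about \<open>D\<close> outside this ring.\<close>

definition derivation :: "nat \<Rightarrow> (cpoly \<Rightarrow> cpoly) \<Rightarrow> bool" where
  "derivation n D \<longleftrightarrow>
     (\<forall>f \<in> poly_ring n. D f \<in> poly_ring n) \<and>
     (\<forall>f \<in> poly_ring n. \<forall>g \<in> poly_ring n. D (f + g) = D f + D g) \<and>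
     (\<forall>c. \<forall>f \<in> poly_ring n. D (const c * f) = const c * D f) \<and>
     (\<forall>f \<in> poly_ring n. \<forall>g \<in> poly_ring n. D (f * g) = D f * g + f * D g)"

definition ker :: "nat \<Rightarrow> (cpoly \<Rightarrow> cpoly) \<Rightarrow> cpoly set" where
  "ker n D = {f \<in> poly_ring n. D f = 0}"

definition chebyshev_U_image :: "nat \<Rightarrow> cpoly" where
  "chebyshev_U_image m = (\<Sum>k<m. (1 + (-1) ^ (m - k + 1)) * of_nat (k + 1) * var k)"

definition chebyshev_U_derivation :: "nat \<Rightarrow> (cpoly \<Rightarrow> cpoly) \<Rightarrow> bool" where
  "chebyshev_U_derivation n D \<longleftrightarrow>
     derivation n D \<and> D (var 0) = 0 \<and> (\<forall>m \<in> {1..n}. D (var m) = chebyshev_U_image m)"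

text \<open>Elements of the field of fractions.\<close>

definition X :: "nat \<Rightarrow> cpoly fract" where
  "X i = to_fract (var i)"

definition lam :: "cpoly fract" where
  "lam = - X 1 / (2 * X 0)"

text \<open>
  \<open>Sum_any\<close> adds up the nonzero terms of a family with finite support; see
  \<open>sigma_finite_support\<close> below for the finiteness of the support.
\<close>

definition sigma :: "(cpoly \<Rightarrow> cpoly) \<Rightarrow> cpoly \<Rightarrow> cpoly fract" where
  "sigma D f = Sum_any (\<lambda>k. to_fract ((D ^^ k) f) * lam ^ k / of_nat (fact k))"

definition cayley_U :: "nat \<Rightarrow> (cpoly \<Rightarrow> cpoly) \<Rightarrow> cpoly fract" where
  "cayley_U n D = X 0 ^ (n - 1) * sigma D (var n)"

definition falling :: "'a::comm_ring_1 \<Rightarrow> nat \<Rightarrow> 'a" where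
  "falling a m = (\<Prod>j<m. a - of_nat j)"


subsection \<open>Closure properties of the polynomial ring\<close>

lemma poly_ring_0: "0 \<in> poly_ring n"
  by (simp add: poly_ring_def)

lemma poly_ring_single: "Poly_Mapping.keys t \<subseteq> {..n} \<Longrightarrow> Poly_Mapping.single t c \<in> poly_ring n"
  by (auto simp: poly_ring_def)

lemma poly_ring_const: "const c \<in> poly_ring n"
  by (simp add: const_def poly_ring_single)

lemma poly_ring_var: "i \<le> n \<Longrightarrow> var i \<in> poly_ring n"
  by (simp add: var_def poly_ring_single)

lemma poly_ring_add: "f \<in> poly_ring n \<Longrightarrow> g \<in> poly_ring n \<Longrightarrow> f + g \<in> poly_ring n"
  unfolding poly_ring_def using Poly_Mapping.keys_add[of f g] by blast

lemma poly_ring_mult: "f \<in> poly_ring n \<Longrightarrow> g \<in> poly_ring n \<Longrightarrow> f * g \<in> poly_ring n"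
  unfolding poly_ring_def using keys_mult[of f g] by (fastforce dest!: subsetD[OF Poly_Mapping.keys_add])

lemma poly_ring_sum: "(\<And>i. i \<in> I \<Longrightarrow> f i \<in> poly_ring n) \<Longrightarrow> sum f I \<in> poly_ring n"
  by (induction I rule: infinite_finite_induct) (auto simp: poly_ring_0 intro!: poly_ring_add)

lemma const_simps:
  "const 0 = 0" "const 1 = 1" "const (a + b) = const a + const b"
  "const (a * b) = const a * const b" "const (- a) = - const a"
  by (simp_all add: const_def single_add mult_single single_uminus)

lemma const_of_nat: "const (of_nat k) = of_nat k"
  by (induction k) (simp_all add: const_simps)

lemma const_power: "const (a ^ k) = const a ^ k"
  by (induction k) (simp_all add: const_simps)

lemma chebyshev_U_image_const:
  "chebyshev_U_image m =
     (\<Sum>k<m. const ((1 + (-1) ^ (m - k + 1)) * of_nat (k + 1)) * var k)"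
  unfolding chebyshev_U_image_def by (simp only: const_simps const_power const_of_nat)

lemma poly_ring_chebyshev_U_image: "m \<le> Suc n \<Longrightarrow> chebyshev_U_image m \<in> poly_ring n"
  unfolding chebyshev_U_image_const
  by (intro poly_ring_sum poly_ring_mult poly_ring_const poly_ring_var) auto


subsection \<open>Finiteness of the sum defining \<open>sigma\<close>\<close>

context
  fixes n :: nat and D :: "cpoly \<Rightarrow> cpoly"
  assumes D: "chebyshev_U_derivation n D"
begin

lemma
  shows derivation_poly_ring: "f \<in> poly_ring n \<Longrightarrow> D f \<in> poly_ring n"
    and derivation_add: "f \<in> poly_ring n \<Longrightarrow> g \<in> poly_ring n \<Longrightarrow> D (f + g) = D f + D g"
    and derivation_scale: "f \<in> poly_ring n \<Longrightarrow> D (const c * f) = const c * D f"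
  using D unfolding chebyshev_U_derivation_def derivation_def by blast+

lemma derivation_iter: "f \<in> poly_ring n \<Longrightarrow> (D ^^ j) f \<in> poly_ring n"
  by (induction j) (simp_all add: derivation_poly_ring)

lemma derivation_0: "D 0 = 0"
  using derivation_scale[OF poly_ring_0, of 0] by (simp add: const_simps)

lemma derivation_iter_0: "(D ^^ j) 0 = 0"
  by (induction j) (simp_all add: derivation_0)

lemma derivation_iter_add:
  "f \<in> poly_ring n \<Longrightarrow> g \<in> poly_ring n \<Longrightarrow> (D ^^ j) (f + g) = (D ^^ j) f + (D ^^ j) g"
  by (induction j) (simp_all add: derivation_add derivation_iter)

lemma derivation_iter_scale:
  "f \<in> poly_ring n \<Longrightarrow> (D ^^ j) (const c * f) = const c * (D ^^ j) f"
  by (induction j) (simp_all add: derivation_scale derivation_iter)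

lemma derivation_iter_sum:
  "(\<And>i. i \<in> I \<Longrightarrow> f i \<in> poly_ring n) \<Longrightarrow> (D ^^ j) (sum f I) = (\<Sum>i\<in>I. (D ^^ j) (f i))"
  by (induction I rule: infinite_finite_induct)
    (auto simp: derivation_iter_0 derivation_iter_add poly_ring_sum)

lemma derivation_iter_var_eq_0: "m \<le> n \<Longrightarrow> m < j \<Longrightarrow> (D ^^ j) (var m) = 0"
proof (induction m arbitrary: j rule: less_induct)
  case (less m)
  then obtain i where j: "j = Suc i" "m \<le> i"
    by (cases j) auto
  have Dm: "D (var m) = chebyshev_U_image m"
    using D less.prems by (cases m) (auto simp: chebyshev_U_derivation_def chebyshev_U_image_def)
  have "(D ^^ j) (var m) = (D ^^ i) (chebyshev_U_image m)"
    by (simp add: j(1) funpow_Suc_right Dm del: funpow.simps)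
  also have "\<dots> = (\<Sum>k<m. (D ^^ i) (const ((1 + (-1) ^ (m - k + 1)) * of_nat (k + 1)) * var k))"
    unfolding chebyshev_U_image_const using less.prems
    by (intro derivation_iter_sum poly_ring_mult poly_ring_const poly_ring_var) auto
  also have "\<dots> = 0"
  proof (intro sum.neutral ballI)
    fix k assume "k \<in> {..<m}"
    then have "(D ^^ i) (var k) = 0" "var k \<in> poly_ring n"
      using less j by (auto intro: poly_ring_var)
    then show "(D ^^ i) (const ((1 + (-1) ^ (m - k + 1)) * of_nat (k + 1)) * var k) = 0"
      by (simp only: derivation_iter_scale mult_zero_right)
  qed
  finally show ?case .
qed

lemma sigma_finite_support:
  "finite {k. to_fract ((D ^^ k) (var n)) * lam ^ k / of_nat (fact k) \<noteq> 0}"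
proof (rule finite_subset)
  show "{k. to_fract ((D ^^ k) (var n)) * lam ^ k / of_nat (fact k) \<noteq> 0} \<subseteq> {..n}"
    using derivation_iter_var_eq_0[of n] by (auto simp: not_less[symmetric])
qed simp

end


subsection \<open>Existence of the derivation\<close>

definition mono_deriv :: "nat \<Rightarrow> (nat \<Rightarrow>\<^sub>0 nat) \<Rightarrow> cpoly" where
  "mono_deriv n t = (\<Sum>m\<le>n. of_nat (Poly_Mapping.lookup t m) *
     Poly_Mapping.single (t - Poly_Mapping.single m 1) 1 * chebyshev_U_image m)"

definition poly_deriv :: "nat \<Rightarrow> cpoly \<Rightarrow> cpoly" where
  "poly_deriv n p = (\<Sum>t\<in>Poly_Mapping.keys p. const (Poly_Mapping.lookup p t) * mono_deriv n t)"

lemma poly_deriv_superset: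
  assumes "finite A" "Poly_Mapping.keys p \<subseteq> A"
  shows "poly_deriv n p = (\<Sum>t\<in>A. const (Poly_Mapping.lookup p t) * mono_deriv n t)"
  unfolding poly_deriv_def using assms
  by (intro sum.mono_neutral_left) (auto simp: in_keys_iff const_simps)

lemma poly_deriv_add: "poly_deriv n (p + q) = poly_deriv n p + poly_deriv n q"
proof -
  let ?A = "Poly_Mapping.keys p \<union> Poly_Mapping.keys q"
  have "Poly_Mapping.keys (p + q) \<subseteq> ?A" by (rule Poly_Mapping.keys_add)
  then show ?thesis
    by (simp add: poly_deriv_superset[of ?A] lookup_add const_simps distrib_right sum.distrib)
qed

lemma poly_deriv_single: "poly_deriv n (Poly_Mapping.single t c) = const c * mono_deriv n t"
  by (subst poly_deriv_superset[of "{t}"]) auto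

lemma cpoly_induct:
  assumes "P 0" "\<And>p t c. P p \<Longrightarrow> P (p + Poly_Mapping.single t c)"
  shows "P (p :: cpoly)"
proof (induction p rule: update_induct)
  case (update f a b)
  have "Poly_Mapping.update a b f = f + Poly_Mapping.single a b"
    using update by (intro poly_mapping_eqI)
      (auto simp: lookup_update lookup_add lookup_single in_keys_iff when_def)
  then show ?case using assms(2)[OF update.IH] by (simp only:)
qed (fact assms(1))

lemma mono_deriv_add:
  "mono_deriv n (s + t) =
     mono_deriv n s * Poly_Mapping.single t 1 + Poly_Mapping.single s 1 * mono_deriv n t"
proof -
  have shift: "of_nat (Poly_Mapping.lookup t m) * Poly_Mapping.single (s + t - Poly_Mapping.single m 1) 1 =
      of_nat (Poly_Mapping.lookup t m) * (Poly_Mapping.single s 1 *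
        Poly_Mapping.single (t - Poly_Mapping.single m 1) (1::complex))" for s t :: "nat \<Rightarrow>\<^sub>0 nat" and m
  proof (cases "Poly_Mapping.lookup t m = 0")
    case False
    then have "s + t - Poly_Mapping.single m 1 = s + (t - Poly_Mapping.single m 1)"
      by (intro poly_mapping_eqI) (auto simp: lookup_add lookup_minus lookup_single when_def)
    then show ?thesis by (simp add: mult_single)
  qed simp
  have "mono_deriv n (s + t) = (\<Sum>m\<le>n.
      of_nat (Poly_Mapping.lookup s m) * Poly_Mapping.single (t + s - Poly_Mapping.single m 1) 1 * chebyshev_U_image m +
      of_nat (Poly_Mapping.lookup t m) * Poly_Mapping.single (s + t - Poly_Mapping.single m 1) 1 * chebyshev_U_image m)"
    by (simp add: mono_deriv_def lookup_add algebra_simps)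
  then show ?thesis
    unfolding shift mono_deriv_def
    by (simp add: sum.distrib sum_distrib_left sum_distrib_right mult_ac)
qed

lemma poly_deriv_mult: "poly_deriv n (p * q) = poly_deriv n p * q + p * poly_deriv n q"
proof (induction p rule: cpoly_induct)
  case (2 p s a)
  have "poly_deriv n (Poly_Mapping.single s a * q) =
      poly_deriv n (Poly_Mapping.single s a) * q + Poly_Mapping.single s a * poly_deriv n q"
  proof (induction q rule: cpoly_induct)
    case (2 q t b)
    have split: "Poly_Mapping.single u c = const c * Poly_Mapping.single u 1"
      for u :: "nat \<Rightarrow>\<^sub>0 nat" and c
      by (simp add: const_def mult_single)
    have "poly_deriv n (Poly_Mapping.single s a * Poly_Mapping.single t b) =
      poly_deriv n (Poly_Mapping.single s a) * Poly_Mapping.single t b +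
      Poly_Mapping.single s a * poly_deriv n (Poly_Mapping.single t b)"
      unfolding mult_single poly_deriv_single mono_deriv_add
      unfolding split[of s a] split[of t b]
      by (simp add: const_simps algebra_simps)
    then show ?case by (simp only: 2 distrib_left poly_deriv_add add_ac)
  qed (simp add: poly_deriv_def)
  then show ?case by (simp only: 2 distrib_right poly_deriv_add add_ac)
qed (simp add: poly_deriv_def)

lemma poly_deriv_var: "m \<le> n \<Longrightarrow> poly_deriv n (var m) = chebyshev_U_image m"
proof -
  assume "m \<le> n"
  have "mono_deriv n (Poly_Mapping.single m 1) =
      (\<Sum>i\<le>n. if i = m then chebyshev_U_image m else 0)"
    unfolding mono_deriv_def by (intro sum.cong) (auto simp: lookup_single when_def)
  with \<open>m \<le> n\<close> show ?thesis
    by (simp add: var_def poly_deriv_single const_simps)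
qed

lemma poly_deriv_poly_ring: "f \<in> poly_ring n \<Longrightarrow> poly_deriv n f \<in> poly_ring n"
proof -
  assume f: "f \<in> poly_ring n"
  have "mono_deriv n t \<in> poly_ring n" if "t \<in> Poly_Mapping.keys f" for t
  proof -
    have "Poly_Mapping.keys (t - Poly_Mapping.single m 1) \<subseteq> Poly_Mapping.keys t" for m
      by (auto simp: in_keys_iff lookup_minus)
    then have "Poly_Mapping.keys (t - Poly_Mapping.single m 1) \<subseteq> {..n}" for m
      using that f unfolding poly_ring_def by blast
    then show ?thesis
      unfolding mono_deriv_def const_of_nat[symmetric]
      by (intro poly_ring_sum poly_ring_mult poly_ring_const poly_ring_single
          poly_ring_chebyshev_U_image) auto
  qed
  then show ?thesis
    unfolding poly_deriv_def by (intro poly_ring_sum poly_ring_mult poly_ring_const)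
qed

lemma chebyshev_U_derivation_exists: "chebyshev_U_derivation n (poly_deriv n)"
proof -
  have const: "poly_deriv n (const c) = 0" for c
    by (simp add: const_def poly_deriv_single mono_deriv_def)
  then show ?thesis
    by (auto simp: chebyshev_U_derivation_def derivation_def poly_deriv_add poly_deriv_mult
        poly_deriv_poly_ring poly_deriv_var chebyshev_U_image_def)
qed

end

theory Submission
  imports Defs
begin

text \<open>
  Iterating \<open>D\<close> on \<open>x\<^sub>n\<close> gives \<open>2\<^sup>k\<close> times a combination of the \<open>x\<^sub>m\<close> with \<open>m = n - k - 2 i\<close>, whose
  coefficients satisfy a recursion in \<open>k\<close>; the sum in the recursion telescopes.
  Substituted into \<open>\<sigma>(x\<^sub>n)\<close> this is the stated expansion.  Only its term \<open>k = n\<close> has a denominator,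
  and there \<open>D\<^sup>n(x\<^sub>n)\<close> is a multiple of \<open>x\<^sub>0\<close>, so the Cayley element is a polynomial \<open>P\<close>.
  Since \<open>D(\<lambda>) = -1\<close>, applying \<open>D\<close> to the polynomial \<open>x\<^sub>0 P\<close> gives a telescoping sum with value \<open>0\<close>.
  Then \<open>x\<^sub>0 D(P) = 0\<close>, and so \<open>D(P) = 0\<close>.
\<close>

section \<open>Combinatorics of the coefficients\<close>

text \<open>The sign factor is 2 for odd \<open>m - k\<close> and 0 otherwise; the surviving indices
  are \<open>k = m - 1 - 2 * b\<close>.\<close>

lemma chebyshev_U_image_odd_steps:
  "chebyshev_U_image m = 2 * (\<Sum>b<(m + 1) div 2. of_nat (m - 2 * b) * var (m - 1 - 2 * b))"
proof -
  have "chebyshev_U_image m =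
      (\<Sum>j\<in>{j. j < m \<and> odd (m - j)}. 2 * (of_nat (j + 1) * var j))"
    unfolding chebyshev_U_image_def
    by (intro sum.mono_neutral_cong_right) auto
  also have "\<dots> = (\<Sum>b<(m + 1) div 2. 2 * (of_nat (m - 2 * b) * var (m - 1 - 2 * b)))"
  proof (rule sum.reindex_bij_witness[of _ "\<lambda>b. m - 1 - 2 * b" "\<lambda>j. (m - 1 - j) div 2"])
    fix j assume "j \<in> {j. j < m \<and> odd (m - j)}"
    then have "even (m - 1 - j)" "j < m"
      by (auto elim!: oddE)
    then obtain c where "m - 1 - j = 2 * c"
      by (blast elim: evenE)
    with \<open>j < m\<close> have "m = Suc (j + 2 * c)"
      by simp
    then show "m - 1 - 2 * ((m - 1 - j) div 2) = j" "(m - 1 - j) div 2 \<in> {..<(m + 1) div 2}"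
      "2 * (of_nat (m - 2 * ((m - 1 - j) div 2)) * var (m - 1 - 2 * ((m - 1 - j) div 2))) =
        2 * (of_nat (j + 1) * var j)"
      by (auto simp: Suc_diff_le)
  next
    fix b assume "b \<in> {..<(m + 1) div 2}"
    then have "Suc (2 * b) \<le> m"
      by auto
    then have "m = Suc (2 * b + (m - Suc (2 * b)))"
      by simp
    then obtain d where "m = Suc (2 * b + d)" ..
    then show "m - 1 - 2 * b \<in> {j. j < m \<and> odd (m - j)}" "(m - 1 - (m - 1 - 2 * b)) div 2 = b"
      by auto
  qed
  finally show ?thesis
    by (simp only: sum_distrib_left)
qed

text \<open>
  The truncated subtraction is harmless: when \<open>a < m\<close> the product contains a factor \<open>0\<close>, as does
  the falling factorial.
\<close>

definition ffact :: "nat \<Rightarrow> nat \<Rightarrow> nat" where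
  "ffact a m = (\<Prod>j<m. a - j)"

lemma ffact_Suc: "ffact a (Suc m) = ffact a m * (a - m)"
  by (simp add: ffact_def)

lemma ffact_Suc_Suc: "ffact (Suc a) (Suc m) = Suc a * ffact a m"
  unfolding ffact_def by (subst prod.lessThan_Suc_shift) simp

lemma falling_of_nat: "falling (of_nat a) m = (of_nat (ffact a m) :: 'a::comm_ring_1)"
proof (induction m)
  case (Suc m)
  have "falling (of_nat a) (Suc m) = of_nat (ffact a m) * (of_nat a - of_nat m :: 'a)"
    using Suc by (simp add: falling_def)
  moreover have "ffact a m = 0" if "a < m"
    using that unfolding ffact_def by (intro prod_zero) auto
  ultimately show ?case
    by (cases "a < m") (simp_all add: ffact_Suc of_nat_diff)
qed (simp add: falling_def ffact_def)

text \<open>The index \<open>k\<close> is shifted by one: \<open>coeff_U n k\<close> belongs to the iterate \<open>D\<^sup>k\<^sup>+\<^sup>1(x\<^sub>n)\<close>.\<close>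

definition coeff_U :: "nat \<Rightarrow> nat \<Rightarrow> nat \<Rightarrow> nat" where
  "coeff_U n k i = ffact (n - i) k * ((k + i) choose k) * (n - k - 2 * i)"

text \<open>Induction on \<open>i\<close>: after factoring out \<open>ffact m k\<close>, the step
  follows from Pascal's rule and absorption.\<close>

lemma sum_coeff_U:
  assumes "Suc k + 2 * i \<le> n"
  shows "(\<Sum>a\<le>i. coeff_U n k a) = ffact (n - i) (Suc k) * ((Suc k + i) choose Suc k)"
  using assms
proof (induction i)
  case 0
  then show ?case by (simp add: coeff_U_def ffact_Suc)
next
  case (Suc i)
  define m where "m = n - Suc i"
  have m: "n - i = Suc m" "n - Suc i = m" "k + Suc i \<le> m"
    using Suc.prems by (auto simp: m_def)
  obtain d where d: "m = k + Suc i + d"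
    using m(3) le_Suc_ex by blast
  have n: "n - k - 2 * Suc i = d"
    using d Suc.prems m_def by auto
  define B where "B = (Suc k + i) choose k"
  define B' where "B' = (Suc k + i) choose Suc k"
  \<comment> \<open>Absorption: both sides equal (k+i+1)! / (k! i!).\<close>
  have BB: "Suc k * B' = Suc i * B"
    unfolding B_def B'_def
    by (metis Suc_times_binomial_add add_Suc add_Suc_right)
  have "(\<Sum>a\<le>Suc i. coeff_U n k a) = Suc m * ffact m k * B' + ffact m k * B * d"
    using Suc m n by (simp add: coeff_U_def B_def B'_def ffact_Suc_Suc)
  also have "\<dots> = ffact m k * (Suc m * B' + B * d)"
    by algebra
  also have "Suc m * B' + B * d = (m - k) * (B + B')"
  proof -
    have "Suc m * B' = (Suc i + d) * B' + Suc k * B'" using d by (simp add: algebra_simps)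
    also note BB
    finally show ?thesis using d by (simp add: algebra_simps)
  qed
  finally show ?case
    by (simp add: m ffact_Suc B_def B'_def mult.assoc)
qed

text \<open>The recursion behind one more application of \<open>D\<close>: every
  \<open>a \<le> i\<close> feeds the same variable, with a common factor.\<close>

lemma sum_coeff_U_mult:
  assumes "2 * i < n - k"
  shows "(\<Sum>a\<le>i. coeff_U n k a) * (n - k - 1 - 2 * i) = coeff_U n (Suc k) i"
  using sum_coeff_U[of k i n] assms by (simp add: coeff_U_def)

section \<open>Scalars and the field of fractions\<close>

lemma var_neq_0: "var i \<noteq> 0"
proof
  assume "var i = 0"
  then have "Poly_Mapping.lookup (var i) (Poly_Mapping.single i 1) = 0"
    by (simp only: lookup_zero)
  then show False
    by (simp add: var_def)
qed

text \<open>Since \<open>\<lambda> = -x\<^sub>1 / (2 x\<^sub>0)\<close>, this is the scalar part of \<open>\<lambda>\<^sup>k / k!\<close>.\<close>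

definition cofactor :: "nat \<Rightarrow> complex" where
  "cofactor k = (- 1 / 2) ^ k / of_nat (fact k)"

text \<open>Scalar form of D(\<lambda>^(k+1) / (k+1)!) = -\<lambda>^k / k!; the factor 2 comes from
  D(x_1) = 2 x_0.\<close>

lemma cofactor_Suc: "cofactor (Suc k) * (2 * of_nat (Suc k)) = - cofactor k"
proof -
  have "(of_nat (Suc k) :: complex) \<noteq> 0"
    by (rule of_nat_neq_0)
  then show ?thesis
    unfolding cofactor_def fact_Suc of_nat_mult by (simp add: divide_simps del: of_nat_Suc)
qed

lemma const_cofactor_Suc: "const (cofactor (Suc k)) * (2 * of_nat (Suc k)) = - const (cofactor k)"
proof -
  have "const (cofactor (Suc k)) * (of_nat 2 * of_nat (Suc k)) = - const (cofactor k)"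
    by (simp only: const_simps(4,5)[symmetric] const_of_nat[symmetric] of_nat_numeral cofactor_Suc)
  then show ?thesis by simp
qed

lemma to_fract_of_nat: "to_fract (of_nat k) = of_nat k"
  by (induction k) simp_all

lemma to_fract_power: "to_fract (a ^ k) = to_fract a ^ k"
  by (induction k) simp_all

text \<open>Characteristic 0 permits division by 2 and by k!.\<close>

lemma of_nat_cpoly_fract_eq_0_iff: "(of_nat k :: cpoly fract) = 0 \<longleftrightarrow> k = 0"
proof -
  have "const (of_nat k) = 0 \<longleftrightarrow> k = 0"
    by (simp add: const_def)
  then show ?thesis
    by (simp add: const_of_nat flip: to_fract_of_nat)
qed

lemma two_cpoly_fract: "(2 :: cpoly fract) \<noteq> 0"
  using of_nat_cpoly_fract_eq_0_iff[of 2] by simp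

lemma X_neq_0: "X i \<noteq> 0"
  by (simp add: X_def var_neq_0)

lemma to_fract_const_cofactor:
  "to_fract (const (cofactor k)) = (- 1 / 2) ^ k / of_nat (fact k)"
proof -
  \<comment> \<open>Denominators are cleared first, so that only ring operations pass through
    \<open>const\<close> and \<open>to_fract\<close>.\<close>
  have "cofactor k * (of_nat (2 ^ k) * of_nat (fact k)) = (- 1) ^ k"
    unfolding cofactor_def power_divide by simp
  then have "to_fract (const (cofactor k * (of_nat (2 ^ k) * of_nat (fact k)))) = to_fract (const ((- 1) ^ k))"
    by simp
  then have "to_fract (const (cofactor k)) * (2 ^ k * of_nat (fact k)) = (- 1) ^ k"
    by (simp only: const_simps const_of_nat const_power to_fract_of_nat to_fract_power to_fract_mult
        to_fract_uminus to_fract_1) simp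
  then show ?thesis
    using two_cpoly_fract of_nat_cpoly_fract_eq_0_iff[of "fact k"]
    unfolding power_divide by (simp add: eq_divide_eq mult_ac)
qed

lemma lam_power: "lam ^ k = (- 1 / 2) ^ k * (X 1 ^ k / X 0 ^ k)"
  unfolding lam_def power_divide power_mult_distrib power_minus[of "X 1"] by simp

lemma X_0_power_mult_lam_power:
  assumes "k \<le> m"
  shows "X 0 ^ m * lam ^ k = (- 1 / 2) ^ k * (X 1 ^ k * X 0 ^ (m - k))"
proof -
  have "X 0 ^ m = X 0 ^ (m - k) * X 0 ^ k"
    using assms by (simp flip: power_add)
  then show ?thesis
    unfolding lam_power using X_neq_0[of 0] by simp
qed

lemma poly_ring_of_nat: "of_nat c \<in> poly_ring n"
  using poly_ring_const[of "of_nat c" n] by (simp only: const_of_nat)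

lemma poly_ring_power: "f \<in> poly_ring n \<Longrightarrow> f ^ k \<in> poly_ring n"
  using poly_ring_of_nat[of 1] by (induction k) (auto intro: poly_ring_mult)

section \<open>Iterates of \<open>D\<close> on x_n\<close>

context
  fixes n :: nat and D :: "cpoly \<Rightarrow> cpoly"
  assumes n: "n \<ge> 1" and D: "chebyshev_U_derivation n D"
begin

lemma
  shows D_mult: "f \<in> poly_ring n \<Longrightarrow> g \<in> poly_ring n \<Longrightarrow> D (f * g) = D f * g + f * D g"
    and D_var: "m \<le> n \<Longrightarrow> D (var m) = chebyshev_U_image m"
  using D unfolding chebyshev_U_derivation_def derivation_def
  \<comment> \<open>For \<open>m = 0\<close> the image is the empty sum, in agreement with D(x_0) =
    0.\<close>
  by (blast, cases m) (auto simp: chebyshev_U_image_def)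

lemma D_of_nat_mult: "f \<in> poly_ring n \<Longrightarrow> D (of_nat c * f) = of_nat c * D f"
  using derivation_scale[OF D, of f "of_nat c"] by (simp only: const_of_nat)

lemma D_sum:
  "(\<And>i. i \<in> I \<Longrightarrow> f i \<in> poly_ring n) \<Longrightarrow> D (sum f I) = (\<Sum>i\<in>I. D (f i))"
  using derivation_iter_sum[OF D, of I f 1] by simp

lemma D_one: "D 1 = 0"
  using D_mult[of 1 1] poly_ring_of_nat[of 1] by simp

lemma D_power: "f \<in> poly_ring n \<Longrightarrow> D (f ^ Suc k) = of_nat (Suc k) * f ^ k * D f"
proof (induction k)
  case (Suc k)
  then have "D (f ^ Suc (Suc k)) = D f * f ^ Suc k + f * D (f ^ Suc k)"
    using D_mult[of f "f ^ Suc k"] poly_ring_power[of f n "Suc k"] by simp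
  with Suc show ?case by (simp add: algebra_simps)
qed (simp add: D_one)

text \<open>The range consists of the \<open>i\<close> with \<open>Suc k + 2 * i \<le> n\<close>, so
  no index is truncated; it is empty once \<open>k \<ge> n\<close>.\<close>

lemma iter_var:
  "(D ^^ Suc k) (var n) =
     2 ^ Suc k * (\<Sum>i<(n + 1 - k) div 2. of_nat (coeff_U n k i) * var (n - Suc k - 2 * i))"
proof (induction k)
  case 0
  have "coeff_U n 0 b = n - 2 * b" for b
    by (simp add: coeff_U_def ffact_def)
  then show ?case
    using D_var[of n] by (simp add: chebyshev_U_image_odd_steps)
next
  case (Suc k)
  define N where "N = (n - k) div 2"
  define M where "M = (n + 1 - k) div 2"
  define Y where "Y i = (of_nat (n - k - 1 - 2 * i) * var (n - k - 2 - 2 * i) :: cpoly)" for i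
  have in_ring: "of_nat c * var (n - d) \<in> poly_ring n" for c d
    by (intro poly_ring_mult poly_ring_of_nat poly_ring_var) simp
  \<comment> \<open>\<open>Y\<close> depends only on \<open>a + b\<close>, which allows grouping
    along diagonals. For \<open>a \<ge> N\<close> both sides vanish.\<close>
  have inner: "D (var (n - Suc k - 2 * a)) = 2 * (\<Sum>b<N - a. Y (a + b))" for a
  proof -
    have "(n - Suc k - 2 * a + 1) div 2 = N - a"
      unfolding N_def by (cases "n \<ge> Suc k + 2 * a") auto
    then show ?thesis
      by (simp add: D_var chebyshev_U_image_odd_steps Y_def algebra_simps)
  qed
  have NM: "N \<le> M"
    by (auto simp: N_def M_def intro: div_le_mono)
  have "(D ^^ Suc (Suc k)) (var n) =
      D (of_nat (2 ^ Suc k) * (\<Sum>i<M. of_nat (coeff_U n k i) * var (n - Suc k - 2 * i)))"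
    using Suc by (simp add: M_def)
  also have "\<dots> = of_nat (2 ^ Suc k) * (\<Sum>a<M. D (of_nat (coeff_U n k a) * var (n - Suc k - 2 * a)))"
    using in_ring by (subst D_of_nat_mult, force intro: poly_ring_sum, subst D_sum) simp_all
  also have "\<dots> = of_nat (2 ^ Suc k) *
      (\<Sum>a<M. of_nat (coeff_U n k a) * (2 * (\<Sum>b<N - a. Y (a + b))))"
  proof -
    have "var (n - Suc k - 2 * a) \<in> poly_ring n" for a
      by (simp add: poly_ring_var)
    then show ?thesis
      by (simp only: D_of_nat_mult inner)
  qed
  also have "\<dots> = 2 ^ Suc (Suc k) * (\<Sum>a<M. \<Sum>b<N - a. of_nat (coeff_U n k a) * Y (a + b))"
    by (simp add: sum_distrib_left mult_ac)
  \<comment> \<open>As \<open>N \<le> M\<close>, the nonempty inner ranges make up exactly the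
    triangle \<open>a + b < N\<close>.\<close>
  also have "(\<Sum>a<M. \<Sum>b<N - a. of_nat (coeff_U n k a) * Y (a + b)) =
      (\<Sum>(a, b)\<in>{(a, b). a + b < N}. of_nat (coeff_U n k a) * Y (a + b))"
    using NM by (subst sum.Sigma) (auto intro!: sum.cong)
  also have "\<dots> = (\<Sum>i<N. of_nat (\<Sum>a\<le>i. coeff_U n k a) * Y i)"
    by (simp add: sum.triangle_reindex sum_distrib_right)
  also have "\<dots> = (\<Sum>i<N. of_nat (coeff_U n (Suc k) i) * var (n - Suc (Suc k) - 2 * i))"
  proof (intro sum.cong refl)
    fix i assume "i \<in> {..<N}"
    then have "(\<Sum>a\<le>i. coeff_U n k a) * (n - k - 1 - 2 * i) = coeff_U n (Suc k) i"
      by (intro sum_coeff_U_mult) (auto simp: N_def)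
    then show "of_nat (\<Sum>a\<le>i. coeff_U n k a) * Y i =
        of_nat (coeff_U n (Suc k) i) * var (n - Suc (Suc k) - 2 * i)"
      unfolding Y_def by (simp only: mult.assoc[symmetric] of_nat_mult[symmetric]) simp
  qed
  finally show ?case
    by (simp add: N_def)
qed

section \<open>Telescoping under \<open>D\<close>\<close>

text \<open>The summand of \<open>x\<^sub>0\<^sup>n \<sigma>(x\<^sub>n)\<close>, free of denominators.\<close>

definition term_U :: "nat \<Rightarrow> cpoly" where
  "term_U k = const (cofactor k) * ((D ^^ k) (var n) * (var 1 ^ k * var 0 ^ (n - k)))"

lemma in_ring:
  "(D ^^ k) (var n) \<in> poly_ring n" "var 0 \<in> poly_ring n" "var 1 \<in> poly_ring n"
  using n by (auto intro: derivation_iter[OF D] poly_ring_var)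

lemma D_var_0_power: "D (var 0 ^ k) = 0"
proof (cases k)
  case (Suc j)
  then show ?thesis
    using D_power[OF in_ring(2), of j] D_var[of 0] by (simp add: chebyshev_U_image_def)
qed (simp add: D_one)

lemma D_var_1_power: "D (var 1 ^ Suc k) = 2 * of_nat (Suc k) * var 1 ^ k * var 0"
  using D_power[OF in_ring(3), of k] D_var[of 1] n
  by (simp add: chebyshev_U_image_def mult_ac)

lemma D_term_U:
  "D (term_U k) = const (cofactor k) * ((D ^^ Suc k) (var n) * (var 1 ^ k * var 0 ^ (n - k)) +
     (D ^^ k) (var n) * (D (var 1 ^ k) * var 0 ^ (n - k)))"
proof -
  have ring: "var 1 ^ k \<in> poly_ring n" "var 0 ^ (n - k) \<in> poly_ring n" for k
    by (intro poly_ring_power in_ring)+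
  show ?thesis
    unfolding term_U_def
    by (subst derivation_scale[OF D] D_mult, (intro poly_ring_mult in_ring ring)+)+
      (simp add: D_var_0_power)
qed

text \<open>The Leibniz part from x_1^(k+1) cancels the term left by index \<open>k\<close>, by
  \<open>const_cofactor_Suc\<close>. The boundary term vanishes at \<open>m = n\<close>, since
  D^(n+1)(x_n) = 0.\<close>

lemma sum_D_term_U:
  "m \<le> n \<Longrightarrow> (\<Sum>k\<le>m. D (term_U k)) =
     const (cofactor m) * ((D ^^ Suc m) (var n) * (var 1 ^ m * var 0 ^ (n - m)))"
proof (induction m)
  case 0
  then show ?case by (simp add: D_term_U D_one)
next
  case (Suc m)
  \<comment> \<open>This splits off the x_0 that D(x_1) = 2 x_0 supplies in the next
    summand.\<close>
  have x: "var 0 ^ (n - m) = var 0 * var 0 ^ (n - Suc m)"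
    using Suc.prems by (metis Suc_diff_Suc Suc_le_lessD power_Suc)
  define A where "A = (D ^^ Suc m) (var n)"
  define C where "C = const (cofactor (Suc m))"
  have C: "const (cofactor m) = - (C * (2 * of_nat (Suc m)))"
    using const_cofactor_Suc[of m] by (simp add: C_def del: of_nat_Suc)
  have "(\<Sum>k\<le>Suc m. D (term_U k)) =
      const (cofactor m) * (A * (var 1 ^ m * var 0 ^ (n - m))) + D (term_U (Suc m))"
    using Suc by (simp add: A_def)
  also have "\<dots> = C * ((D ^^ Suc (Suc m)) (var n) * (var 1 ^ Suc m * var 0 ^ (n - Suc m)))"
    unfolding D_term_U D_var_1_power C x A_def[symmetric] C_def[symmetric]
    by (simp add: algebra_simps del: of_nat_Suc funpow.simps power_Suc)
  finally show ?case
    by (simp only: C_def)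
qed

lemma D_sum_term_U: "D (\<Sum>k\<le>n. term_U k) = 0"
proof -
  have "D (\<Sum>k\<le>n. term_U k) = (\<Sum>k\<le>n. D (term_U k))"
    unfolding term_U_def
    by (intro D_sum poly_ring_mult poly_ring_const poly_ring_power in_ring)
  also have "\<dots> = 0"
    using derivation_iter_var_eq_0[OF D, of n "Suc n"] by (simp only: sum_D_term_U) simp
  finally show ?thesis .
qed

section \<open>The Cayley element as a polynomial in the kernel\<close>

text \<open>At the last step the range of \<open>iter_var\<close> shrinks to
  \<open>i = 0\<close>.\<close>

lemma iter_var_n: "(D ^^ n) (var n) = of_nat (2 ^ n * coeff_U n (n - 1) 0) * var 0"
  using iter_var[of "n - 1"] n by simp

text \<open>In the last summand the factor \<open>x\<^sub>0\<close> of \<open>D\<^sup>n(x\<^sub>n)\<close> is cancelled against \<open>x\<^sub>0\<^sup>-\<^sup>1\<close>.\<close>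

definition poly_U :: cpoly where
  "poly_U = (\<Sum>k<n. const (cofactor k) * ((D ^^ k) (var n) * (var 1 ^ k * var 0 ^ (n - 1 - k)))) +
     const (cofactor n) * (of_nat (2 ^ n * coeff_U n (n - 1) 0) * var 1 ^ n)"

lemma poly_U_in_ring: "poly_U \<in> poly_ring n"
  unfolding poly_U_def
  by (intro poly_ring_add poly_ring_sum poly_ring_mult poly_ring_const poly_ring_power in_ring
      poly_ring_of_nat)

lemma var_0_mult_poly_U: "var 0 * poly_U = (\<Sum>k\<le>n. term_U k)"
proof -
  have "var 0 * (const (cofactor k) * ((D ^^ k) (var n) * (var 1 ^ k * var 0 ^ (n - 1 - k)))) =
      term_U k" if "k < n" for k
  proof -
    have "var 0 ^ (n - k) = var 0 * var 0 ^ (n - 1 - k)"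
      using that by (metis Suc_diff_Suc diff_Suc_eq_diff_pred power_Suc)
    then show ?thesis
      by (simp only: term_U_def mult_ac)
  qed
  moreover have "var 0 * (const (cofactor n) * (of_nat (2 ^ n * coeff_U n (n - 1) 0) * var 1 ^ n)) =
      term_U n"
    unfolding term_U_def iter_var_n by (simp add: mult_ac)
  ultimately have "var 0 * poly_U = (\<Sum>k<n. term_U k) + term_U n"
    unfolding poly_U_def by (simp only: distrib_left sum_distrib_left) simp
  then show ?thesis
    by (simp add: lessThan_Suc_atMost[symmetric])
qed

lemma poly_U_in_ker: "poly_U \<in> ker n D"
proof -
  have "var 0 * D poly_U = D (var 0 * poly_U)"
    using D_mult[OF in_ring(2) poly_U_in_ring] D_var_0_power[of 1] by simp
  also have "\<dots> = 0"
    by (simp only: var_0_mult_poly_U D_sum_term_U)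
  finally show ?thesis
    using var_neq_0[of 0] poly_U_in_ring by (simp add: ker_def)
qed

lemma sigma_var:
  "sigma D (var n) = (\<Sum>k\<le>n. to_fract ((D ^^ k) (var n)) * lam ^ k / of_nat (fact k))"
  unfolding sigma_def
  using derivation_iter_var_eq_0[OF D, of n]
  by (intro Sum_any.expand_superset) (auto simp flip: not_less)

text \<open>One extra factor x_0 clears the denominator of every \<lambda>^k with
  \<open>k \<le> n\<close>; it is cancelled at the end.\<close>

lemma cayley_U_eq_poly_U: "cayley_U n D = to_fract (poly_U)"
proof -
  have "X 0 * cayley_U n D = X 0 ^ n * sigma D (var n)"
    using n by (cases n) (simp_all add: cayley_U_def)
  also have "\<dots> = (\<Sum>k\<le>n. to_fract (term_U k))"
    unfolding sigma_var sum_distrib_left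
  proof (intro sum.cong refl)
    fix k assume "k \<in> {..n}"
    then have "X 0 ^ n * lam ^ k = (- 1 / 2) ^ k * (X 1 ^ k * X 0 ^ (n - k))"
      by (intro X_0_power_mult_lam_power) simp
    then show "X 0 ^ n * (to_fract ((D ^^ k) (var n)) * lam ^ k / of_nat (fact k)) =
        to_fract (term_U k)"
      by (simp add: term_U_def to_fract_power to_fract_const_cofactor X_def mult_ac)
  qed
  also have "\<dots> = X 0 * to_fract (poly_U)"
    by (simp add: X_def var_0_mult_poly_U flip: to_fract_sum to_fract_mult)
  finally show ?thesis
    using X_neq_0[of 0] by simp
qed

section \<open>The explicit expansion\<close>

text \<open>The factor 2^k of the iterate cancels the 2^k in the denominator of \<lambda>^k.\<close>

lemma cayley_U_term:
  assumes "k \<in> {1..n}"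
  shows "X 0 ^ (n - 1) * (to_fract ((D ^^ k) (var n)) * lam ^ k / of_nat (fact k)) =
    (-1) ^ k / of_nat (fact k) *
      (\<Sum>i = 0..(n - k) div 2.
         falling (of_nat (n - i)) (k - 1) * of_nat ((k + i - 1) choose (k - 1)) *
         of_nat (n - k - 2 * i + 1) *
         X (n - k - 2 * i) * X 1 ^ k * X 0 powi (int n - 1 - int k))"
proof -
  define j where "j = k - 1"
  have k: "k = Suc j" "Suc j \<le> n"
    using assms by (auto simp: j_def)
  define S where "S = (\<Sum>i = 0..(n - k) div 2. of_nat (coeff_U n j i) * X (n - k - 2 * i))"
  have range: "{..<(n + 1 - j) div 2} = {0..(n - k) div 2}"
    using k by auto
  have "to_fract ((D ^^ k) (var n)) = 2 ^ k * S"
    unfolding k(1) iter_var S_def range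
    by (simp add: X_def to_fract_power to_fract_sum to_fract_of_nat to_fract_of_nat[of 2, simplified])
  \<comment> \<open>At \<open>k = n\<close> the exponent is -1, hence the integer power.\<close>
  moreover have "X 0 powi (int n - 1 - int k) = X 0 ^ (n - 1) / X 0 ^ k"
  proof -
    have "int n - 1 - int k = int (n - 1) - int k"
      using n by simp
    then show ?thesis
      using X_neq_0[of 0] by (simp only: power_int_diff power_int_of_nat simp_thms)
  qed
  moreover have "2 ^ k * lam ^ k = (- 1) ^ k * (X 1 ^ k / X 0 ^ k)"
    unfolding lam_power power_divide using two_cpoly_fract by simp
  moreover have "(\<Sum>i = 0..(n - k) div 2.
         falling (of_nat (n - i)) (k - 1) * of_nat ((k + i - 1) choose (k - 1)) *
         of_nat (n - k - 2 * i + 1) *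
         X (n - k - 2 * i) * X 1 ^ k * X 0 powi (int n - 1 - int k)) =
       S * (X 1 ^ k * X 0 powi (int n - 1 - int k))"
    unfolding S_def sum_distrib_right
  proof (intro sum.cong refl)
    fix i assume "i \<in> {0..(n - k) div 2}"
    \<comment> \<open>The bound on \<open>i\<close> keeps \<open>n - k - 2 * i\<close> from being
      truncated.\<close>
    then have "n - k - 2 * i + 1 = n - j - 2 * i"
      using k by auto
    then show "falling (of_nat (n - i)) (k - 1) * of_nat ((k + i - 1) choose (k - 1)) *
         of_nat (n - k - 2 * i + 1) *
         X (n - k - 2 * i) * X 1 ^ k * X 0 powi (int n - 1 - int k) =
       of_nat (coeff_U n j i) * X (n - k - 2 * i) * (X 1 ^ k * X 0 powi (int n - 1 - int k))"
      using k by (simp add: coeff_U_def falling_of_nat mult_ac del: of_nat_diff)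
  qed
  ultimately show ?thesis
    by (simp only: times_divide_eq_right times_divide_eq_left divide_divide_eq_left mult_ac)
qed

lemma cayley_U_expansion:
  "cayley_U n D =
     X n * X 0 ^ (n - 1)
     + (\<Sum>k = 1..n. (-1) ^ k / of_nat (fact k) *
         (\<Sum>i = 0..(n - k) div 2.
            falling (of_nat (n - i)) (k - 1) * of_nat ((k + i - 1) choose (k - 1)) *
            of_nat (n - k - 2 * i + 1) *
            X (n - k - 2 * i) * X 1 ^ k * X 0 powi (int n - 1 - int k)))"
proof -
  \<comment> \<open>The index 0 yields the leading term x_n x_0^(n-1).\<close>
  have "{..n} = insert 0 {1..n}"
    by auto
  then have "cayley_U n D = X n * X 0 ^ (n - 1) +
      (\<Sum>k = 1..n. X 0 ^ (n - 1) * (to_fract ((D ^^ k) (var n)) * lam ^ k / of_nat (fact k)))"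
    by (simp add: cayley_U_def sigma_var X_def distrib_left sum_distrib_left mult_ac)
  then show ?thesis
    by (simp only: cayley_U_term cong: sum.cong)
qed

end

theorem theorem2:
  fixes n :: nat and D :: "cpoly \<Rightarrow> cpoly"
  assumes "n \<ge> 1" and "chebyshev_U_derivation n D"
  shows "cayley_U n D \<in> to_fract ` ker n D
    \<and> cayley_U n D =
        X n * X 0 ^ (n - 1)
        + (\<Sum>k = 1..n. (-1) ^ k / of_nat (fact k) *
            (\<Sum>i = 0..(n - k) div 2.
               falling (of_nat (n - i)) (k - 1) * of_nat ((k + i - 1) choose (k - 1)) *
               of_nat (n - k - 2 * i + 1) *
               X (n - k - 2 * i) * X 1 ^ k * X 0 powi (int n - 1 - int k)))"
proof (rule conjI[OF _ cayley_U_expansion[OF assms]])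
  show "cayley_U n D \<in> to_fract ` ker n D"
    unfolding cayley_U_eq_poly_U[OF assms] using poly_U_in_ker[OF assms] by (rule imageI)
qed

end
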